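(* Let $N, M \ge 1$, let $A \in \mathbb{R}^{N\times N}$, $B \in \mathbb{R}^{N\times M}$, $C \in \mathbb{R}^{M\times N}$, $D \in \mathbb{R}^{M\times M}$, and suppose that the feedback delay network (FDN) with transfer function $H(z) = C\,(\Delta_m(z^{-1}) - A)^{-1} B + D$ is stable. If there exists a diagonal positive definite matrix $P \in \mathbb{R}^{N\times N}$ with $$\begin{bmatrix} A & B \\ C & D\end{bmatrix}\begin{bmatrix} P & 0 \\ 0 & I\end{bmatrix}\begin{bmatrix} A^\top & C^\top \\ B^\top & D^\top\end{bmatrix} = \begin{bmatrix} P & 0 \\ 0 & I\end{bmatrix},$$ then the FDN is uniallpass, i.e., its transfer function is allpass for every choice of the delays $m$.
   Context: For a vector of positive integer delays $m = [m_1,\dots,m_N]$, $\Delta_m(z^{-1}) = \operatorname{diag}(z^{m_1},\dots,z^{m_N})$, and the FDN $(A,B,C,D)$ with delays $m$ has the $M\times M$ rational transfer function matrix $H(z) = C\,(\Delta_m(z^{-1}) - A)^{-1} B + D$. The system poles of the FDN are the roots of the polynomial $\det(\Delta_m(z^{-1}) - A)$ in $z$; the FDN is stable if all its system poles lie strictly inside the unit circle. A rational transfer function matrix $H(z)$ with real coefficients is allpass if $H(z)\,H(z^{-1})^\top = I$ (as an identity of rational matrices). The FDN is uniallpass if, with $A,B,C,D$ fixed, its transfer function is allpass for every vector $m$ of positive integer delays. *)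

theory Defs
  imports
    "HOL-Analysis.Analysis"
    "HOL-Computational_Algebra.Polynomial_Factorial"
    "HOL-Computational_Algebra.Field_as_Ring"
begin

text \<open>
  Real rational functions in the indeterminate \<open>z\<close> are elements of the field
  \<^typ>\<open>real poly fract\<close>, with \<open>z\<close> itself represented by \<open>to_fract [:0, 1:]\<close>.
  The number of delay lines is \<open>CARD('n)\<close>, the number of channels is \<open>CARD('m)\<close>.
\<close>

type_synonym ratfun = "real poly fract"

definition eval_recip :: "real poly \<Rightarrow> ratfun" where
  "eval_recip p = poly (map_poly (\<lambda>c. to_fract [:c:]) p) (inverse (to_fract [:0, 1:]))"

text \<open>
  The substitution of \<open>1/z\<close> for \<open>z\<close>. It does not depend on the chosen fraction, see
  \<open>subst_recip_Fract\<close> below.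
\<close>

definition subst_recip :: "ratfun \<Rightarrow> ratfun" where
  "subst_recip r =
    eval_recip (fst (quot_of_fract r)) / eval_recip (snd (quot_of_fract r))"

text \<open>
  \<open>delay_matrix m\<close> is \<open>\<Delta>\<^sub>m(z\<^sup>-\<^sup>1)\<close>, the diagonal
  matrix with the entries \<open>z ^ m\<^sub>i\<close>.
\<close>

definition delay_matrix :: "nat ^ 'n \<Rightarrow> real poly ^ 'n ^ 'n" where
  "delay_matrix m = (\<chi> i j. if i = j then monom 1 (m $ i) else 0)"

definition loop_matrix :: "real ^ 'n ^ 'n \<Rightarrow> nat ^ 'n \<Rightarrow> real poly ^ 'n ^ 'n" where
  "loop_matrix A m = delay_matrix m - map_matrix (\<lambda>a. [:a:]) A"

definition const_matrix :: "real ^ 'j ^ 'i \<Rightarrow> ratfun ^ 'j ^ 'i" where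
  "const_matrix X = map_matrix (\<lambda>x. to_fract [:x:]) X"

text \<open>
  For positive delays \<open>det (loop_matrix A m)\<close> is monic in \<open>z\<close>, so the inverse below,
  taken over the field of rational functions, exists for every \<open>A\<close>.
\<close>

definition transfer_function ::
  "real ^ 'n ^ 'n \<Rightarrow> real ^ 'm ^ 'n \<Rightarrow> real ^ 'n ^ 'm \<Rightarrow> real ^ 'm ^ 'm \<Rightarrow> nat ^ 'n
    \<Rightarrow> ratfun ^ 'm ^ 'm" where
  "transfer_function A B C D m =
    const_matrix C ** matrix_inv (map_matrix to_fract (loop_matrix A m)) ** const_matrix B
      + const_matrix D"

definition system_poles :: "real ^ 'n ^ 'n \<Rightarrow> nat ^ 'n \<Rightarrow> complex set" where
  "system_poles A m = {z. poly (map_poly complex_of_real (det (loop_matrix A m))) z = 0}"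

definition fdn_stable :: "real ^ 'n ^ 'n \<Rightarrow> nat ^ 'n \<Rightarrow> bool" where
  "fdn_stable A m \<longleftrightarrow> (\<forall>z \<in> system_poles A m. norm z < 1)"

definition allpass :: "ratfun ^ 'm ^ 'm \<Rightarrow> bool" where
  "allpass H \<longleftrightarrow> H ** transpose (map_matrix subst_recip H) = mat 1"

definition uniallpass ::
  "real ^ 'n ^ 'n \<Rightarrow> real ^ 'm ^ 'n \<Rightarrow> real ^ 'n ^ 'm \<Rightarrow> real ^ 'm ^ 'm \<Rightarrow> bool" where
  "uniallpass A B C D \<longleftrightarrow>
    (\<forall>m. (\<forall>i. 0 < m $ i) \<longrightarrow> allpass (transfer_function A B C D m))"

definition diagonal_matrix :: "real ^ 'n ^ 'n \<Rightarrow> bool" where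
  "diagonal_matrix P \<longleftrightarrow> (\<forall>i j. i \<noteq> j \<longrightarrow> P $ i $ j = 0)"

definition positive_definite :: "real ^ 'n ^ 'n \<Rightarrow> bool" where
  "positive_definite P \<longleftrightarrow> transpose P = P \<and> (\<forall>x. x \<noteq> 0 \<longrightarrow> 0 < x \<bullet> (P *v x))"

definition block_matrix ::
  "real ^ 'n ^ 'n \<Rightarrow> real ^ 'm ^ 'n \<Rightarrow> real ^ 'n ^ 'm \<Rightarrow> real ^ 'm ^ 'm
    \<Rightarrow> real ^ ('n + 'm) ^ ('n + 'm)" where
  "block_matrix A B C D =
    (\<chi> i j. case i of
       Inl k \<Rightarrow> (case j of Inl l \<Rightarrow> A $ k $ l | Inr l \<Rightarrow> B $ k $ l)
     | Inr k \<Rightarrow> (case j of Inl l \<Rightarrow> C $ k $ l | Inr l \<Rightarrow> D $ k $ l))"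


lemma eval_recip_0 [simp]: "eval_recip 0 = 0"
  by (simp add: eval_recip_def)

lemma eval_recip_pCons:
  "eval_recip (pCons c p) = to_fract [:c:] + inverse (to_fract [:0, 1:]) * eval_recip p"
  by (simp add: eval_recip_def map_poly_pCons)

lemma eval_recip_add: "eval_recip (p + q) = eval_recip p + eval_recip q"
proof -
  have "map_poly (\<lambda>c. to_fract [:c:]) (p + q)
      = map_poly (\<lambda>c. to_fract [:c:]) p + map_poly (\<lambda>c. to_fract [:c:]) q"
    by (rule poly_eqI) (simp add: coeff_map_poly flip: to_fract_add)
  then show ?thesis by (simp add: eval_recip_def)
qed

lemma eval_recip_smult: "eval_recip (smult c p) = to_fract [:c:] * eval_recip p"
  by (induction p) (simp_all add: eval_recip_pCons algebra_simps flip: to_fract_mult)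

lemma eval_recip_mult: "eval_recip (p * q) = eval_recip p * eval_recip q"
  by (induction p)
    (simp_all add: eval_recip_pCons eval_recip_add eval_recip_smult algebra_simps)

lemma eval_recip_times_power:
  "to_fract [:0, 1:] ^ degree p * eval_recip p = to_fract (reflect_poly p)"
proof (induction p)
  case 0
  then show ?case by simp
next
  case (pCons c p)
  have z: "to_fract [:0, 1::real:] \<noteq> 0" by simp
  have pow: "to_fract (q ^ k) = to_fract q ^ k" for q :: "real poly" and k
    by (induction k) simp_all
  show ?case
  proof (cases "p = 0")
    case True
    then show ?thesis by (cases "c = 0") (simp_all add: eval_recip_pCons)
  next
    case False
    have sm: "smult a q = [:a:] * q" for a :: real and q by simp
    have "reflect_poly (pCons c p) = reflect_poly p + monom c (Suc (degree p))"
      using False by (simp add: reflect_poly_pCons')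
    also have "to_fract \<dots> = to_fract [:0, 1:] ^ degree p * eval_recip p
        + to_fract [:c:] * to_fract [:0, 1:] ^ Suc (degree p)"
      by (simp only: pCons.IH monom_altdef sm pow to_fract_add to_fract_mult)
    finally show ?thesis
      using False z by (simp add: eval_recip_pCons algebra_simps)
  qed
qed

lemma eval_recip_eq_0_iff [simp]: "eval_recip p = 0 \<longleftrightarrow> p = 0"
  by (metis eval_recip_0 eval_recip_times_power mult_zero_right reflect_poly_eq_0_iff
      to_fract_eq_0_iff)

lemma subst_recip_Fract:
  assumes "q \<noteq> 0"
  shows "subst_recip (Fract p q) = eval_recip p / eval_recip q"
proof -
  define a b where "a = fst (quot_of_fract (Fract p q))" "b = snd (quot_of_fract (Fract p q))"
  have b: "b \<noteq> 0" and "Fract a b = Fract p q"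
    by (simp_all add: a_b_def)
  then have "a * q = p * b"
    using assms by (simp add: eq_fract)
  then have "eval_recip a * eval_recip q = eval_recip p * eval_recip b"
    by (simp flip: eval_recip_mult)
  then show ?thesis
    using assms b by (simp add: subst_recip_def frac_eq_eq flip: a_b_def)
qed

end

theory Submission
  imports Defs
begin

text \<open>
  Write \<open>\<Delta>\<close> and \<open>\<Delta>'\<close> for the delay matrices at \<open>z\<close> and \<open>1/z\<close>. Since \<open>P\<close> is diagonal,
  \<open>\<Delta> P \<Delta>' = P\<close> for all delays. With \<open>X = (\<Delta> - A)\<^sup>-\<^sup>1\<close> and \<open>Z = (\<Delta>' - A\<^sup>T)\<^sup>-\<^sup>1\<close>, expanding
  \<open>X P Z = (X \<Delta>) P (\<Delta>' Z) = (1 + X A) P (1 + A\<^sup>T Z)\<close> and inserting \<open>A P A\<^sup>T + B B\<^sup>T = P\<close> gives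
  \<open>X B B\<^sup>T Z = P + X A P + P A\<^sup>T Z\<close>. The remaining blocks of the hypothesis then reduce
  \<open>(C X B + D) (B\<^sup>T Z C\<^sup>T + D\<^sup>T)\<close> to \<open>C P C\<^sup>T + D D\<^sup>T = 1\<close>.
\<close>

lemma matrix_add_rdistrib:
  fixes A B :: "'a::semiring_1 ^ 'n ^ 'm"
  shows "(A + B) ** C = A ** C + B ** C"
  by (vector matrix_matrix_mult_def sum.distrib[symmetric] distrib_right)

lemma matrix_sub_ldistrib:
  fixes B C :: "'a::ring_1 ^ 'n ^ 'm"
  shows "A ** (B - C) = A ** B - A ** C"
  by (vector matrix_matrix_mult_def sum_subtractf[symmetric] right_diff_distrib)

lemma matrix_sub_rdistrib:
  fixes A B :: "'a::ring_1 ^ 'n ^ 'm"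
  shows "(A - B) ** C = A ** C - B ** C"
  by (vector matrix_matrix_mult_def sum_subtractf[symmetric] left_diff_distrib)

text \<open>Pure noncommutative algebra: \<open>At\<close>, \<open>Bt\<close>, \<open>Ct\<close>,
  \<open>Dt\<close> and \<open>\<Delta>'\<close> are free variables, so neither transposition nor
  substitution enters. A left inverse \<open>X\<close> and a right inverse \<open>Z\<close> suffice,
  as the expansion only rewrites \<open>X ** \<Delta>\<close> and
  \<open>\<Delta>' ** Z\<close>.\<close>

lemma lossless_completion:
  fixes A \<Delta> \<Delta>' P X Z At :: "'a::ring_1 ^ 'n ^ 'n"
    and B :: "'a ^ 'm ^ 'n" and C :: "'a ^ 'n ^ 'm" and D Dt :: "'a ^ 'm ^ 'm"
    and Bt :: "'a ^ 'n ^ 'm" and Ct :: "'a ^ 'm ^ 'n"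
  assumes X: "X ** (\<Delta> - A) = mat 1"
    and Z: "(\<Delta>' - At) ** Z = mat 1"
    and P: "\<Delta> ** P ** \<Delta>' = P"
    and 11: "A ** P ** At + B ** Bt = P"
    and 12: "A ** P ** Ct + B ** Dt = 0"
    and 21: "C ** P ** At + D ** Bt = 0"
    and 22: "C ** P ** Ct + D ** Dt = mat 1"
  shows "(C ** X ** B + D) ** (Bt ** Z ** Ct + Dt) = mat 1"
proof -
  have X': "X ** \<Delta> = mat 1 + X ** A"
    using X by (simp add: matrix_sub_ldistrib diff_eq_eq)
  have Z': "\<Delta>' ** Z = mat 1 + At ** Z"
    using Z by (simp add: matrix_sub_rdistrib diff_eq_eq)
  have "X ** P ** Z = (X ** \<Delta>) ** P ** (\<Delta>' ** Z)"
    by (subst P[symmetric]) (simp add: matrix_mul_assoc)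
  also have "\<dots> = P + X ** A ** P + P ** At ** Z + X ** (A ** P ** At) ** Z"
    by (simp add: X' Z' matrix_add_ldistrib matrix_add_rdistrib matrix_mul_assoc add_ac)
  finally have "X ** (P - A ** P ** At) ** Z = P + X ** A ** P + P ** At ** Z"
    by (simp add: matrix_sub_ldistrib matrix_sub_rdistrib algebra_simps)
  moreover have "P - A ** P ** At = B ** Bt"
    using 11 by (simp add: diff_eq_eq add.commute)
  ultimately have XZ: "X ** B ** Bt ** Z = P + X ** A ** P + P ** At ** Z"
    by (simp add: matrix_mul_assoc)
  have "(C ** X ** B + D) ** (Bt ** Z ** Ct + Dt)
      = C ** (X ** B ** Bt ** Z) ** Ct + C ** X ** (B ** Dt) + (D ** Bt) ** Z ** Ct + D ** Dt"
    by (simp add: matrix_add_ldistrib matrix_add_rdistrib matrix_mul_assoc add_ac)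
  \<comment> \<open>Inserting \<open>XZ\<close> gives \<open>C ** P ** Ct\<close> and two terms with
    a single \<open>X\<close> or \<open>Z\<close>; each of these joins the cross term that completes
    an off-diagonal block equation.\<close>
  also have "\<dots> = (C ** P ** Ct + D ** Dt) + C ** X ** (A ** P ** Ct + B ** Dt)
      + (C ** P ** At + D ** Bt) ** Z ** Ct"
    by (simp add: XZ matrix_add_ldistrib matrix_add_rdistrib matrix_mul_assoc add_ac)
  finally show ?thesis
    by (simp add: 12 21 22)
qed

lemma matrix_inv_left:
  assumes "invertible A"
  shows "matrix_inv A ** A = mat 1"
  using assms unfolding invertible_def matrix_inv_def by (rule someI2_ex) blast

lemma map_matrix_compose: "map_matrix f (map_matrix g X) = map_matrix (\<lambda>x. f (g x)) X"
  by (simp add: vec_eq_iff)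

lemma transpose_map_matrix: "transpose (map_matrix f X) = map_matrix f (transpose X)"
  by (simp add: vec_eq_iff transpose_def)

text \<open>Evaluation at a point, the embeddings of polynomials and of constants into fractions,
  and the substitution of \<open>1/z\<close> are all applied entrywise to matrices; one locale
  serves all four.\<close>

locale ring_homomorphism =
  fixes f :: "'a::comm_ring_1 \<Rightarrow> 'b::comm_ring_1"
  assumes hom_add: "f (x + y) = f x + f y"
    and hom_mult: "f (x * y) = f x * f y"
    and hom_1: "f 1 = 1"
begin

lemma hom_0: "f 0 = 0"
  using hom_add[of 0 0] by simp

lemma hom_uminus: "f (- x) = - f x"
  using hom_add[of x "- x"] by (simp add: hom_0 eq_neg_iff_add_eq_0 add.commute)

lemma hom_diff: "f (x - y) = f x - f y"
  using hom_add[of x "- y"] by (simp add: hom_uminus)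

lemma hom_sum: "f (sum g S) = (\<Sum>x\<in>S. f (g x))"
  by (induction S rule: infinite_finite_induct) (simp_all add: hom_0 hom_add)

lemma hom_prod: "f (prod g S) = (\<Prod>x\<in>S. f (g x))"
  by (induction S rule: infinite_finite_induct) (simp_all add: hom_1 hom_mult)

lemma hom_power: "f (x ^ k) = f x ^ k"
  by (induction k) (simp_all add: hom_1 hom_mult)

lemma map_matrix_add: "map_matrix f (X + Y) = map_matrix f X + map_matrix f Y"
  by (simp add: vec_eq_iff hom_add)

lemma map_matrix_diff: "map_matrix f (X - Y) = map_matrix f X - map_matrix f Y"
  by (simp add: vec_eq_iff hom_diff)

lemma map_matrix_mult: "map_matrix f (X ** Y) = map_matrix f X ** map_matrix f Y"
  by (simp add: vec_eq_iff matrix_matrix_mult_def hom_sum hom_mult)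

lemma map_matrix_zero: "map_matrix f 0 = 0"
  by (simp add: vec_eq_iff hom_0)

lemma map_matrix_mat_1: "map_matrix f (mat 1) = mat 1"
  by (simp add: vec_eq_iff mat_def hom_0 hom_1)

lemma det_map_matrix: "det (map_matrix f X) = f (det X)"
  by (auto simp: det_def hom_sum hom_mult hom_prod hom_1 hom_uminus sign_def intro!: sum.cong)

end

interpretation poly_hom: ring_homomorphism "\<lambda>p::'a::comm_ring_1 poly. poly p x" for x
  by unfold_locales simp_all

interpretation to_fract_hom: ring_homomorphism "to_fract :: 'a::idom \<Rightarrow> 'a fract"
  by unfold_locales simp_all

interpretation const_hom: ring_homomorphism "\<lambda>c::'a::idom. to_fract [:c:]"
  by unfold_locales (simp_all add: pCons_one flip: to_fract_add to_fract_mult)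

lemma eval_recip_const: "eval_recip [:c:] = to_fract [:c:]"
  by (simp add: eval_recip_pCons)

lemma eval_recip_1: "eval_recip 1 = 1"
  using eval_recip_const[of 1] by (simp add: pCons_one)

text \<open>Writing the arguments as explicit fractions lets \<open>subst_recip_Fract\<close> bypass
  the canonical representatives; what remains is fraction arithmetic, since
  \<open>eval_recip\<close> keeps nonzero denominators nonzero.\<close>

interpretation subst_recip_hom: ring_homomorphism subst_recip
proof
  fix r s :: ratfun
  obtain a b where r: "r = Fract a b" "b \<noteq> 0" by (cases r) auto
  obtain c d where s: "s = Fract c d" "d \<noteq> 0" by (cases s) auto
  show "subst_recip (r + s) = subst_recip r + subst_recip s"
    using r s by (simp add: subst_recip_Fract eval_recip_add eval_recip_mult add_frac_eq)
  show "subst_recip (r * s) = subst_recip r * subst_recip s"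
    using r s by (simp add: subst_recip_Fract eval_recip_mult)
  show "subst_recip 1 = 1"
    by (simp add: One_fract_def subst_recip_Fract eval_recip_1)
qed

lemma subst_recip_to_fract: "subst_recip (to_fract p) = eval_recip p"
  by (simp add: to_fract_def subst_recip_Fract eval_recip_1)

lemma subst_recip_monom:
  "subst_recip (to_fract (monom 1 k)) = inverse (to_fract (monom 1 k))"
proof -
  have "eval_recip [:0, 1:] = inverse (to_fract [:0, 1:])"
    by (simp add: eval_recip_pCons eval_recip_1 pCons_one)
  then show ?thesis
    by (simp add: monom_altdef to_fract_hom.hom_power subst_recip_hom.hom_power
        subst_recip_to_fract power_inverse)
qed

lemma map_subst_recip_const: "map_matrix subst_recip (const_matrix X) = const_matrix X"
  by (simp add: const_matrix_def map_matrix_compose subst_recip_to_fract eval_recip_const)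

text \<open>One real \<open>t\<close> at which the determinant is nonzero is enough. For
  \<open>t\<close> at least 1 and above the operator norm of \<open>A\<close>, the diagonal of
  powers of \<open>t\<close> stretches every nonzero vector more than \<open>A\<close> can, so the
  kernel is trivial.\<close>

lemma det_loop_matrix_nonzero:
  fixes A :: "real ^ 'n ^ 'n" and m :: "nat ^ 'n"
  assumes m: "\<And>i. 0 < m $ i"
  shows "det (loop_matrix A m) \<noteq> 0"
proof -
  define K where "K = onorm ((*v) A)"
  define t where "t = K + 1"
  have K: "0 \<le> K" unfolding K_def by (rule onorm_pos_le) simp
  define L where "L = map_matrix (\<lambda>p. poly p t) (loop_matrix A m)"
  have ker: "x = 0" if "L *v x = 0" for x
  proof -
    have "(L *v x) $ i = t ^ (m $ i) * x $ i - (A *v x) $ i" for i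
      by (simp add: L_def loop_matrix_def delay_matrix_def matrix_vector_mult_def
          left_diff_distrib sum_subtractf if_distrib[of "\<lambda>p. poly p t"]
          if_distrib[of "\<lambda>y. y * _"] poly_monom cong: if_cong)
    with that have Ax: "(A *v x) $ i = t ^ (m $ i) * x $ i" for i
      by (metis eq_iff_diff_eq_0 zero_index)
    have "norm ((t *\<^sub>R x) $ i) \<le> norm ((A *v x) $ i)" for i
    proof -
      \<comment> \<open>Positivity of the delays enters here: base and exponent are both at least
        1.\<close>
      have "t ^ 1 \<le> t ^ (m $ i)"
        using m[of i] K by (intro power_increasing) (auto simp: t_def)
      then show ?thesis
        using K by (auto simp: Ax abs_mult t_def intro!: mult_right_mono)
    qed
    then have "norm (t *\<^sub>R x) \<le> norm (A *v x)"
      by (rule norm_le_componentwise_cart)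
    also have "\<dots> \<le> K * norm x"
      unfolding K_def by (rule onorm) simp
    finally show "x = 0"
      using K by (simp add: t_def distrib_right)
  qed
  then have "invertible L"
    by (simp add: invertible_left_inverse matrix_left_invertible_ker)
  then have "poly (det (loop_matrix A m)) t \<noteq> 0"
    by (simp add: invertible_det_nz L_def poly_hom.det_map_matrix)
  then show ?thesis by auto
qed

lemma sum_UNIV_plus:
  "sum f (UNIV :: ('a::finite + 'b::finite) set) = (\<Sum>x\<in>UNIV. f (Inl x)) + (\<Sum>y\<in>UNIV. f (Inr y))"
  using sum.Plus[of "UNIV :: 'a set" "UNIV :: 'b set" f] by simp

lemma block_matrix_mult:
  "block_matrix A B C D ** block_matrix A' B' C' D'
    = block_matrix (A ** A' + B ** C') (A ** B' + B ** D') (C ** A' + D ** C') (C ** B' + D ** D')"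
  by (simp add: vec_eq_iff block_matrix_def matrix_matrix_mult_def sum_UNIV_plus
      split: sum.split)

lemma block_matrix_eq_iff:
  "block_matrix A B C D = block_matrix A' B' C' D' \<longleftrightarrow> A = A' \<and> B = B' \<and> C = C' \<and> D = D'"
  by (simp add: vec_eq_iff block_matrix_def split_sum_all) blast

text \<open>Instantiates \<open>lossless_completion\<close> over the rational functions: entrywise
  \<open>subst_recip\<close> followed by transposition turns \<open>X\<close> into
  \<open>Z\<close>.\<close>

lemma allpass_transfer_function:
  fixes A P :: "real ^ 'n ^ 'n" and B :: "real ^ 'm ^ 'n"
    and C :: "real ^ 'n ^ 'm" and D :: "real ^ 'm ^ 'm" and m :: "nat ^ 'n"
  assumes m: "\<And>i. 0 < m $ i"
    and P: "diagonal_matrix P"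
    and eqs: "A ** P ** transpose A + B ** transpose B = P"
      "A ** P ** transpose C + B ** transpose D = 0"
      "C ** P ** transpose A + D ** transpose B = 0"
      "C ** P ** transpose C + D ** transpose D = mat 1"
  shows "allpass (transfer_function A B C D m)"
proof -
  define \<Delta> where "\<Delta> = map_matrix to_fract (delay_matrix m)"
  define X where "X = matrix_inv (map_matrix to_fract (loop_matrix A m))"
  define \<Delta>' where "\<Delta>' = map_matrix subst_recip \<Delta>"
  define Z where "Z = transpose (map_matrix subst_recip X)"
  note const = const_hom.map_matrix_mult const_hom.map_matrix_add
    const_hom.map_matrix_zero const_hom.map_matrix_mat_1

  have loop: "map_matrix to_fract (loop_matrix A m) = \<Delta> - const_matrix A"
    by (simp add: loop_matrix_def \<Delta>_def const_matrix_def to_fract_hom.map_matrix_diff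
        map_matrix_compose)
  have "invertible (map_matrix to_fract (loop_matrix A m))"
    using det_loop_matrix_nonzero[OF m] by (simp add: invertible_det_nz to_fract_hom.det_map_matrix)
  then have X: "X ** (\<Delta> - const_matrix A) = mat 1"
    unfolding X_def loop[symmetric] by (rule matrix_inv_left)

  have \<Delta>': "\<Delta>' = (\<chi> i j. if i = j then inverse (to_fract (monom 1 (m $ i))) else 0)"
    by (simp add: vec_eq_iff \<Delta>'_def \<Delta>_def delay_matrix_def subst_recip_monom
        subst_recip_hom.hom_0)
  then have sym: "transpose \<Delta>' = \<Delta>'"
    by (simp add: vec_eq_iff transpose_def)
  \<comment> \<open>Substitution respects products and transposition reverses them, so the left
    inverse identity for \<open>X\<close> becomes a right inverse identity for
    \<open>Z\<close>.\<close>
  have "transpose (map_matrix subst_recip (X ** (\<Delta> - const_matrix A))) = mat 1"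
    by (simp add: X subst_recip_hom.map_matrix_mat_1)
  moreover have "transpose (\<Delta>' - const_matrix A) = \<Delta>' - const_matrix (transpose A)"
    by (subst sym[symmetric]) (simp add: vec_eq_iff transpose_def const_matrix_def)
  ultimately have Z: "(\<Delta>' - const_matrix (transpose A)) ** Z = mat 1"
    by (simp add: subst_recip_hom.map_matrix_mult subst_recip_hom.map_matrix_diff
        matrix_transpose_mul map_subst_recip_const Z_def \<Delta>'_def)

  have "(\<Delta> ** const_matrix P) $ i $ j = to_fract (monom 1 (m $ i)) * to_fract [:P $ i $ j:]" for i j
    by (simp add: \<Delta>_def delay_matrix_def const_matrix_def matrix_matrix_mult_def
        if_distrib[of to_fract] if_distrib[of "\<lambda>y. y * _"] cong: if_cong)
  then have "(\<Delta> ** const_matrix P ** \<Delta>') $ i $ j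
      = to_fract (monom 1 (m $ i)) * to_fract [:P $ i $ j:] * inverse (to_fract (monom 1 (m $ j)))"
    for i j
    unfolding matrix_matrix_mult_def[of "\<Delta> ** const_matrix P"]
    by (simp add: \<Delta>' if_distrib[of "\<lambda>y. _ * y"] cong: if_cong)
  \<comment> \<open>On the diagonal the powers of \<open>z\<close> cancel; off the diagonal the
    entry of \<open>P\<close> vanishes.\<close>
  then have "(\<Delta> ** const_matrix P ** \<Delta>') $ i $ j = const_matrix P $ i $ j" for i j
    using P by (cases "i = j") (simp_all add: diagonal_matrix_def const_matrix_def)
  then have \<Delta>P: "\<Delta> ** const_matrix P ** \<Delta>' = const_matrix P"
    by (simp add: vec_eq_iff)

  have "(const_matrix C ** X ** const_matrix B + const_matrix D)
      ** (const_matrix (transpose B) ** Z ** const_matrix (transpose C) + const_matrix (transpose D))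
      = mat 1"
    using X Z \<Delta>P
    by (rule lossless_completion)
      (use eqs[THEN arg_cong, of const_matrix] in \<open>simp_all add: const_matrix_def const\<close>)
  \<comment> \<open>This identifies the second factor above: \<open>subst_recip\<close> fixes
    constants, and transposition reverses the order of the factors.\<close>
  moreover have "transpose (map_matrix subst_recip (transfer_function A B C D m))
      = const_matrix (transpose B) ** Z ** const_matrix (transpose C) + const_matrix (transpose D)"
  proof -
    have tr_add: "transpose (U + V) = transpose U + transpose V" for U V :: "ratfun ^ 'm ^ 'm"
      by (simp add: vec_eq_iff transpose_def)
    have tr_const: "transpose (const_matrix U) = const_matrix (transpose U)" for U :: "real ^ 'j ^ 'i"
      by (simp add: const_matrix_def transpose_map_matrix)
    show ?thesis
      by (simp add: transfer_function_def subst_recip_hom.map_matrix_add tr_add tr_const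
          subst_recip_hom.map_matrix_mult map_subst_recip_const matrix_transpose_mul
          matrix_mul_assoc flip: X_def Z_def)
  qed
  ultimately show ?thesis
    by (simp add: allpass_def transfer_function_def flip: X_def)
qed

theorem theorem3:
  fixes A :: "real ^ 'n ^ 'n" and B :: "real ^ 'm ^ 'n"
    and C :: "real ^ 'n ^ 'm" and D :: "real ^ 'm ^ 'm"
    and m :: "nat ^ 'n"
  assumes "\<And>i. 0 < m $ i"
    and "fdn_stable A m"
    and "\<exists>P :: real ^ 'n ^ 'n. diagonal_matrix P \<and> positive_definite P \<and>
      block_matrix A B C D ** block_matrix P 0 0 (mat 1)
          ** block_matrix (transpose A) (transpose C) (transpose B) (transpose D)
        = block_matrix P 0 0 (mat 1)"
  shows "uniallpass A B C D"
proof -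
  obtain P :: "real ^ 'n ^ 'n" where P: "diagonal_matrix P"
    and eq: "block_matrix A B C D ** block_matrix P 0 0 (mat 1)
          ** block_matrix (transpose A) (transpose C) (transpose B) (transpose D)
        = block_matrix P 0 0 (mat 1)"
    using assms(3) by blast
  \<comment> \<open>Comparing blocks yields four equations that do not mention the delays, so one
    \<open>P\<close> serves every choice of them.\<close>
  from eq show ?thesis
    unfolding uniallpass_def
    by (auto simp: block_matrix_mult block_matrix_eq_iff intro!: allpass_transfer_function[OF _ P])
qed

end
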